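(* Let $T$ be a splitting tree such that $T \rightarrow_{\mathrm{cont}} (\mathbb{SP})^2_2$. Then $\mathrm{wsacks}_{\mathrm{cont}}(T)$ holds.
   Context: A tree is a set $T \subseteq 2^{<\omega}$ closed under initial segments; $[T]$ is its set of infinite branches (a subspace of $2^\omega$). For $t \in T$, $T \restriction t = \{ s \in T : s \subseteq t \text{ or } t \subseteq s\}$. For $a \subseteq \omega$ and $X \subseteq 2^{\leq \omega}$, $X$ covers $a$ if for every $n \in a$ and $i \in 2$ there is $s \in X$ with $n \in \operatorname{dom}(s)$ and $s(n) = i$. A tree $T \subseteq 2^{<\omega}$ is a splitting tree if for every $t \in T$, $T \restriction t$ covers a cofinite subset of $\omega$. $\mathbb{SP}$ is the set of splitting trees ordered by inclusion; $\dot x_{\mathrm{gen}}$ is the $\mathbb{SP}$-name for the generic real. $T \rightarrow_{\mathrm{cont}} (\mathbb{SP})^2_2$ means: for every continuous coloring $c \colon [[T]]^2 \to 2$ of the two-element subsets of $[T]$, there is a splitting tree $S \subseteq T$ such that $c$ is constant on $[[S]]^2$. $\mathrm{wsacks}_{\mathrm{cont}}(T)$ means: for every $g \colon \omega \to \omega$ with $g(n) \to \infty$ and every continuous $f \colon [T] \to \omega^\omega$, there are a splitting tree $S \subseteq T$, $a \in [\omega]^\omega$ and $H \in \prod_{n \in a}[\omega]^{g(n)}$ such that $S \Vdash_{\mathbb{SP}} \forall n \in a\, (f(\dot x_{\mathrm{gen}})(n) \in H(n))$. Here $[\omega]^k$ is the set of $k$-element subsets of $\omega$. *)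

theory Defs
  imports "HOL-Analysis.Analysis" "HOL-Library.Sublist" "HOL-Library.Ramsey"
begin

section \<open>Trees on binary strings\<close>

text \<open>
  Elements of $2^{<\omega}$ are boolean lists, elements of $2^\omega$ are functions
  from the naturals to the booleans. The latter carry the product topology (of the discrete
  topology) as the library topology on function types, and likewise for $\omega^\omega$.
\<close>

type_synonym tree = "bool list set"

text \<open>Trees are taken to be nonempty; otherwise the empty set would be vacuously a splitting
  tree and the least forcing condition.\<close>

definition is_tree :: "tree \<Rightarrow> bool" where
  "is_tree T \<longleftrightarrow> T \<noteq> {} \<and> (\<forall>t\<in>T. \<forall>s. prefix s t \<longrightarrow> s \<in> T)"

definition initial :: "(nat \<Rightarrow> bool) \<Rightarrow> nat \<Rightarrow> bool list" where
  "initial x n = map x [0..<n]"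

definition branches :: "tree \<Rightarrow> (nat \<Rightarrow> bool) set" where
  "branches T = {x. \<forall>n. initial x n \<in> T}"

definition restrict_tree :: "tree \<Rightarrow> bool list \<Rightarrow> tree" where
  "restrict_tree T t = {s \<in> T. prefix s t \<or> prefix t s}"

definition covers :: "bool list set \<Rightarrow> nat set \<Rightarrow> bool" where
  "covers X a \<longleftrightarrow> (\<forall>n\<in>a. \<forall>i. \<exists>s\<in>X. n < length s \<and> s ! n = i)"

definition splitting_tree :: "tree \<Rightarrow> bool" where
  "splitting_tree T \<longleftrightarrow>
     is_tree T \<and> (\<forall>t\<in>T. \<exists>a. finite (- a) \<and> covers (restrict_tree T t) a)"

definition SP :: "tree set" where
  "SP = {T. splitting_tree T}"


section \<open>Partition relation\<close>

text \<open>A coloring of unordered pairs is continuous if it is continuous as a function of the two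
  (distinct) points of the pair.\<close>

definition continuous_coloring :: "(nat \<Rightarrow> bool) set \<Rightarrow> ((nat \<Rightarrow> bool) set \<Rightarrow> bool) \<Rightarrow> bool" where
  "continuous_coloring X c \<longleftrightarrow>
     continuous_on {(x, y). x \<in> X \<and> y \<in> X \<and> x \<noteq> y} (\<lambda>(x, y). c {x, y})"

definition SP_arrow_cont :: "tree \<Rightarrow> bool" where
  "SP_arrow_cont T \<longleftrightarrow>
     (\<forall>c. continuous_coloring (branches T) c \<longrightarrow>
        (\<exists>S. splitting_tree S \<and> S \<subseteq> T \<and> c constant_on nsets (branches S) 2))"


section \<open>Forcing\<close>

text \<open>
  A name for a subset of a ground-model set is a set of pairs of an element (standing for its
  check name) and a condition; its value under a generic filter $G$ is the set of all first
  components whose second component lies in $G$. The sentences below are the countably infinitary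
  propositional combinations of membership statements about such names. For them the definability
  of forcing is the usual recursion on the sentence.
\<close>

type_synonym ('a, 'p) name = "('a \<times> 'p) set"

datatype ('a, 'p) sentence =
    Mem 'a "('a, 'p) name"
  | Neg "('a, 'p) sentence"
  | Conj "nat set" "nat \<Rightarrow> ('a, 'p) sentence"

primrec forces ::
  "'p set \<Rightarrow> ('p \<Rightarrow> 'p \<Rightarrow> bool) \<Rightarrow> 'p \<Rightarrow> ('a, 'p) sentence \<Rightarrow> bool" where
  "forces P le p (Mem x \<tau>) \<longleftrightarrow>
     (\<forall>q\<in>P. le q p \<longrightarrow> (\<exists>r\<in>P. le r q \<and> (\<exists>s. (x, s) \<in> \<tau> \<and> le r s)))"
| "forces P le p (Neg \<phi>) \<longleftrightarrow> (\<forall>q\<in>P. le q p \<longrightarrow> \<not> forces P le q \<phi>)"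
| "forces P le p (Conj J \<Phi>) \<longleftrightarrow> (\<forall>j\<in>J. forces P le p (\<Phi> j))"

text \<open>Quantification over a countable ground-model set is a countable conjunction or
  disjunction.\<close>

definition All_in :: "'b::countable set \<Rightarrow> ('b \<Rightarrow> ('a, 'p) sentence) \<Rightarrow> ('a, 'p) sentence" where
  "All_in A \<phi> = Conj (to_nat ` A) (\<lambda>j. \<phi> (from_nat j))"

definition Ex_in :: "'b::countable set \<Rightarrow> ('b \<Rightarrow> ('a, 'p) sentence) \<Rightarrow> ('a, 'p) sentence" where
  "Ex_in A \<phi> = Neg (All_in A (\<lambda>b. Neg (\<phi> b)))"

lemma forces_All_in: "forces P le p (All_in A \<phi>) \<longleftrightarrow> (\<forall>b\<in>A. forces P le p (\<phi> b))"
  by (simp add: All_in_def)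

lemma forces_Ex_in:
  "forces P le p (Ex_in A \<phi>) \<longleftrightarrow>
     (\<forall>q\<in>P. le q p \<longrightarrow> (\<exists>r\<in>P. le r q \<and> (\<exists>b\<in>A. forces P le r (\<phi> b))))"
  unfolding Ex_in_def by (simp add: forces_All_in) blast

abbreviation SP_forces :: "tree \<Rightarrow> ('a, tree) sentence \<Rightarrow> bool" where
  "SP_forces \<equiv> forces SP (\<subseteq>)"

text \<open>
  The generic real is the unique real that is a branch of every tree in the generic filter. As the
  graph of a function it consists of the pairs $(n, i)$ such that all branches of some tree in the
  generic filter take the value $i$ at $n$.
\<close>

definition x_gen :: "(nat \<times> bool, tree) name" where
  "x_gen = {((n, i), p). p \<in> SP \<and> (\<forall>x\<in>branches p. x n = i)}"

definition starts_with :: "bool list \<Rightarrow> (nat \<times> bool, 'p) name \<Rightarrow> (nat \<times> bool, 'p) sentence" where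
  "starts_with s \<xi> = All_in {..<length s} (\<lambda>m. Mem (m, s ! m) \<xi>)"

text \<open>
  In the extension, a continuous function $f$ on $[T]$ is identified with its canonical extension
  to the reinterpreted $[T]$: the value at $\xi$ in place $n$ is $k$ iff some initial segment
  $s \in T$ of $\xi$ is such that in the ground model $f(x)(n) = k$ for all branches $x$ of $T$
  through $s$.
\<close>

definition decides_value ::
  "tree \<Rightarrow> ((nat \<Rightarrow> bool) \<Rightarrow> nat \<Rightarrow> nat) \<Rightarrow> nat \<Rightarrow> nat \<Rightarrow> bool list set" where
  "decides_value T f n k =
     {s \<in> T. \<forall>x\<in>branches T. initial x (length s) = s \<longrightarrow> f x n = k}"

definition value_eq ::
  "tree \<Rightarrow> ((nat \<Rightarrow> bool) \<Rightarrow> nat \<Rightarrow> nat) \<Rightarrow> (nat \<times> bool, 'p) name \<Rightarrow> nat \<Rightarrow> nat \<Rightarrow>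
     (nat \<times> bool, 'p) sentence" where
  "value_eq T f \<xi> n k = Ex_in (decides_value T f n k) (\<lambda>s. starts_with s \<xi>)"

definition value_in ::
  "tree \<Rightarrow> ((nat \<Rightarrow> bool) \<Rightarrow> nat \<Rightarrow> nat) \<Rightarrow> (nat \<times> bool, 'p) name \<Rightarrow> nat \<Rightarrow> nat set \<Rightarrow>
     (nat \<times> bool, 'p) sentence" where
  "value_in T f \<xi> n K = Ex_in K (\<lambda>k. value_eq T f \<xi> n k)"

definition wsacks_cont :: "tree \<Rightarrow> bool" where
  "wsacks_cont T \<longleftrightarrow>
     (\<forall>g :: nat \<Rightarrow> nat. \<forall>f :: (nat \<Rightarrow> bool) \<Rightarrow> nat \<Rightarrow> nat.
        filterlim g at_top sequentially \<and> continuous_on (branches T) f \<longrightarrow>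
        (\<exists>S a H. splitting_tree S \<and> S \<subseteq> T \<and> infinite a \<and>
           H \<in> (\<Pi>\<^sub>E n\<in>a. nsets UNIV (g n)) \<and>
           SP_forces S (All_in a (\<lambda>n. value_in T f x_gen n (H n)))))"

end

theory Submission
  imports Defs
begin

text \<open>
  By compactness, \<open>f x n\<close> depends only on a finite initial segment of \<open>x\<close>, whose length can be
  chosen uniformly in \<open>x\<close>. Hence there are levels \<open>m 0 < m 1 < \<dots>\<close> and arguments \<open>N k\<close> with
  \<open>2 ^ m k \<le> g (N k)\<close> such that \<open>f x (N k)\<close> is determined by the first \<open>m (k + 1)\<close> values
  of \<open>x\<close>. Colour a pair of branches by the parity of the \<open>k\<close> with
  \<open>m k \<le> \<Delta>(x, y) < m (k + 1)\<close>. A homogeneous splitting tree does not split between levels \<open>m k\<close>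
  and \<open>m (k + 1)\<close> for any \<open>k\<close> of one fixed parity. For those \<open>k\<close>, the value \<open>f x (N k)\<close> is already
  determined by the first \<open>m k\<close> values of the branch \<open>x\<close>, so it takes at most
  \<open>2 ^ m k \<le> g (N k)\<close> values.
\<close>

section \<open>Branches and compactness\<close>

lemma length_initial [simp]: "length (initial x n) = n"
  by (simp add: initial_def)

lemma nth_initial [simp]: "i < n \<Longrightarrow> initial x n ! i = x i"
  by (simp add: initial_def)

lemma initial_eq_iff: "initial x n = initial y n \<longleftrightarrow> (\<forall>i<n. x i = y i)"
  by (auto simp: initial_def)

lemma branches_mono: "S \<subseteq> T \<Longrightarrow> branches S \<subseteq> branches T"
  by (auto simp: branches_def)

lemma open_coordinate:
  fixes i :: nat and b :: bool
  shows "open {x. x i = b}"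
proof -
  have "open ((\<lambda>x::nat \<Rightarrow> bool. x i) -` {b})"
    by (intro open_vimage continuous_on_product_coordinates open_discrete)
  then show ?thesis
    by (simp add: vimage_def)
qed

text \<open>The set is a union of cylinders, each a finite intersection of conditions on single
  coordinates. With \<open>P\<close> arbitrary this covers both cylinders and the complement of
  \<open>branches T\<close>.\<close>

lemma open_initial_vimage: "open {x. P (initial x n)}"
proof -
  have cyl: "open {y. initial y n = initial x n}" for x
  proof -
    have "{y. initial y n = initial x n} = (\<Inter>i\<in>{..<n}. {y. y i = x i})"
      by (auto simp: initial_eq_iff)
    then show ?thesis
      by (auto intro: open_coordinate)
  qed
  have "{x. P (initial x n)} = (\<Union>x\<in>{x. P (initial x n)}. {y. initial y n = initial x n})"
    by auto
  then show ?thesis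
    using cyl by (metis (no_types, lifting) open_UN)
qed

lemma compact_branches: "compact (branches T)"
proof -
  have "compact_space (product_topology (\<lambda>i::nat. euclidean::bool topology) UNIV)"
    by (simp add: compact_space_product_topology) (simp add: compact_space_def finite_imp_compact)
  then have "compact (UNIV :: (nat \<Rightarrow> bool) set)"
    by (simp add: euclidean_product_topology compact_space_def)
  moreover have "closed (branches T)"
  proof -
    have "- branches T = (\<Union>n. {x. initial x n \<notin> T})"
      by (auto simp: branches_def)
    then show ?thesis
      unfolding closed_def by (auto intro!: open_UN open_initial_vimage[of "\<lambda>s. s \<notin> T"])
  qed
  ultimately show ?thesis
    by (metis closed_Int_compact Int_UNIV_right)
qed

text \<open>As the codomain is discrete, \<open>{h x}\<close> is open, and a basic product
  neighbourhood of \<open>x\<close> restricts only finitely many coordinates; \<open>m\<close> lies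
  above all of them.\<close>

lemma continuous_on_initial_nbhd:
  fixes h :: "(nat \<Rightarrow> bool) \<Rightarrow> 'a::discrete_topology"
  assumes "continuous_on X h" "x \<in> X"
  shows "\<exists>m. \<forall>y\<in>X. initial y m = initial x m \<longrightarrow> h y = h x"
proof -
  have "open {h x}"
    by (rule open_discrete)
  then obtain A where "open A" "x \<in> A" and A: "\<forall>y\<in>X. y \<in> A \<longrightarrow> h y \<in> {h x}"
    using assms unfolding continuous_on_topological by blast
  have "openin (product_topology (\<lambda>i. euclidean) UNIV) A"
    using \<open>open A\<close> by (simp add: open_fun_def)
  then obtain U where U: "finite {i. U i \<noteq> topspace (euclidean :: bool topology)}"
    "x \<in> Pi\<^sub>E UNIV U" "Pi\<^sub>E UNIV U \<subseteq> A"
    using \<open>x \<in> A\<close> unfolding openin_product_topology_alt by auto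
  then obtain m where m: "\<forall>i. U i \<noteq> UNIV \<longrightarrow> i < m"
    using finite_nat_set_iff_bounded[of "{i. U i \<noteq> UNIV}"] by auto
  have "y \<in> A" if "initial y m = initial x m" for y
  proof -
    have "y i \<in> U i" for i
      using that m U(2) by (cases "i < m") (auto simp: initial_eq_iff PiE_iff)
    then show ?thesis
      using U(3) by auto
  qed
  then show ?thesis
    using A by blast
qed

text \<open>Cylinders on which \<open>h\<close> is constant cover the compact set
  \<open>branches T\<close>. The largest length in a finite subcover works for all branches.\<close>

lemma continuous_on_branches_uniform:
  fixes h :: "(nat \<Rightarrow> bool) \<Rightarrow> 'a::discrete_topology"
  assumes "continuous_on (branches T) h"
  shows "\<exists>m. \<forall>x\<in>branches T. \<forall>y\<in>branches T. initial x m = initial y m \<longrightarrow> h x = h y"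
proof -
  from continuous_on_initial_nbhd[OF assms] obtain m where
    m: "\<And>x y. x \<in> branches T \<Longrightarrow> y \<in> branches T \<Longrightarrow> initial y (m x) = initial x (m x) \<Longrightarrow> h y = h x"
    by metis
  define U where "U = (\<lambda>x. {y. initial y (m x) = initial x (m x)})"
  have "open (U x)" for x
    unfolding U_def by (rule open_initial_vimage)
  moreover have "branches T \<subseteq> (\<Union>x\<in>branches T. U x)"
    by (auto simp: U_def)
  ultimately obtain C where C: "C \<subseteq> branches T" "finite C" "branches T \<subseteq> (\<Union>x\<in>C. U x)"
    by (metis compactE_image[OF compact_branches])
  have "h x = h y"
    if x: "x \<in> branches T" and y: "y \<in> branches T"
      and eq: "initial x (Max (m ` C)) = initial y (Max (m ` C))" for x y
  proof -
    obtain z where z: "z \<in> C" "x \<in> U z"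
      using C(3) x by blast
    then have "m z \<le> Max (m ` C)"
      using C(2) by simp
    then have "y \<in> U z"
      using z(2) eq unfolding U_def mem_Collect_eq initial_eq_iff by (metis order_less_le_trans)
    have "z \<in> branches T"
      using C(1) z(1) by blast
    then have "h x = h z" "h y = h z"
      using m[of z x] m[of z y] x y z(2) \<open>y \<in> U z\<close> unfolding U_def by blast+
    then show ?thesis
      by simp
  qed
  then show ?thesis
    by blast
qed

section \<open>Splitting trees\<close>

lemma covers_mono: "covers X a \<Longrightarrow> X \<subseteq> Y \<Longrightarrow> covers Y a"
  unfolding covers_def by blast

lemma splitting_tree_extend:
  assumes "splitting_tree T" "t \<in> T"
  shows "\<exists>b. t @ [b] \<in> T"
proof -
  obtain a where a: "finite (- a)" "covers (restrict_tree T t) a"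
    using assms unfolding splitting_tree_def by blast
  \<comment> \<open>A node compatible with \<open>t\<close> that has such an \<open>n\<close> in its
    domain must properly extend \<open>t\<close>.\<close>
  obtain n where n: "n \<ge> length t" "n \<in> a"
    using a(1) unfolding finite_nat_set_iff_bounded by (metis ComplI leI less_asym' max.cobounded1 max.cobounded2 not_less)
  then obtain s where s: "s \<in> restrict_tree T t" "n < length s"
    using a(2) unfolding covers_def by blast
  then have "s \<in> T" "prefix t s"
    using n by (auto simp: restrict_tree_def dest: prefix_length_le)
  then obtain u where u: "s = t @ u" "u \<noteq> []"
    using s(2) n(1) by (cases "s = t") (auto simp: prefix_def)
  then have "prefix (t @ [hd u]) s"
    by (cases u) auto
  then show ?thesis
    using \<open>s \<in> T\<close> assms(1) unfolding splitting_tree_def is_tree_def by blast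
qed

lemma splitting_tree_has_branch:
  assumes "splitting_tree T"
  shows "\<exists>x. x \<in> branches T"
proof -
  have "[] \<in> T"
    using assms unfolding splitting_tree_def is_tree_def by (metis Nil_prefix all_not_in_conv)
  have "\<exists>t. \<forall>n. (t n \<in> T \<and> length (t n) = n) \<and> (\<exists>b. t (Suc n) = t n @ [b])"
  proof (rule dependent_nat_choice)
    show "\<exists>t. t \<in> T \<and> length t = 0"
      using \<open>[] \<in> T\<close> by simp
  next
    fix t and n :: nat
    assume "t \<in> T \<and> length t = n"
    moreover from this obtain b where "t @ [b] \<in> T"
      using splitting_tree_extend[OF assms] by blast
    ultimately show "\<exists>u. (u \<in> T \<and> length u = Suc n) \<and> (\<exists>b. u = t @ [b])"
      by (intro exI[of _ "t @ [b]"]) auto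
  qed
  then obtain t where t: "\<And>n. t n \<in> T" "\<And>n. length (t n) = n" "\<And>n. \<exists>b. t (Suc n) = t n @ [b]"
    by blast
  define x where "x = (\<lambda>n. last (t (Suc n)))"
  have "initial x n = t n" for n
  proof (induction n)
    case 0
    then show ?case
      using t(2)[of 0] by (simp add: initial_def)
  next
    case (Suc n)
    obtain b where "t (Suc n) = t n @ [b]"
      using t(3) by blast
    then show ?case
      using Suc by (simp add: initial_def x_def)
  qed
  then show ?thesis
    using t(1) by (auto simp: branches_def intro: exI[of _ x])
qed

text \<open>A node \<open>s\<close> of the restriction is comparable with \<open>t\<close>. If
  \<open>v\<close> is the longer of the two, everything in \<open>T\<close> comparable with
  \<open>v\<close> is comparable with both, so the covering property at \<open>v\<close> carries
  over to \<open>s\<close>.\<close>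

lemma splitting_tree_restrict_tree:
  assumes "splitting_tree T" "t \<in> T"
  shows "splitting_tree (restrict_tree T t)"
  unfolding splitting_tree_def is_tree_def
proof (intro conjI ballI allI impI)
  show "restrict_tree T t \<noteq> {}"
    using assms(2) by (auto simp: restrict_tree_def)
next
  fix s u
  assume "s \<in> restrict_tree T t" "prefix u s"
  then show "u \<in> restrict_tree T t"
    using assms(1) prefix_same_cases[of u s t] unfolding restrict_tree_def splitting_tree_def is_tree_def
    by (auto intro: prefix_order.trans)
next
  fix s
  assume s: "s \<in> restrict_tree T t"
  have "\<exists>v\<in>T. restrict_tree T v \<subseteq> restrict_tree (restrict_tree T t) s"
  proof (cases "prefix t s")
    case True
    then have "restrict_tree T s \<subseteq> restrict_tree (restrict_tree T t) s"
      unfolding restrict_tree_def using prefix_same_cases by (auto intro: prefix_order.trans)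
    then show ?thesis
      using s by (auto simp: restrict_tree_def)
  next
    case False
    then have "prefix s t"
      using s by (auto simp: restrict_tree_def)
    then have "restrict_tree T t \<subseteq> restrict_tree (restrict_tree T t) s"
      unfolding restrict_tree_def using prefix_same_cases by (auto intro: prefix_order.trans)
    then show ?thesis
      using assms(2) by blast
  qed
  then show "\<exists>a. finite (- a) \<and> covers (restrict_tree (restrict_tree T t) s) a"
    using assms(1) covers_mono unfolding splitting_tree_def by meson
qed

lemma branch_restrict_tree:
  assumes "x \<in> branches (restrict_tree T t)"
  shows "initial x (length t) = t"
proof -
  have "prefix (initial x (length t)) t \<or> prefix t (initial x (length t))"
    using assms by (auto simp: branches_def restrict_tree_def)
  then show ?thesis
    by (metis length_initial order_refl prefix_length_prefix prefix_order.eq_iff)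
qed

section \<open>Forcing statements about values at the generic real\<close>

text \<open>Every condition \<open>p\<close> below \<open>q\<close> occurs itself as a second
  component in \<open>x_gen\<close> for each pair \<open>(i, t ! i)\<close>, so \<open>p\<close>
  serves as its own witness for density.\<close>

lemma SP_forces_starts_with:
  assumes "\<And>x. x \<in> branches q \<Longrightarrow> initial x (length t) = t"
  shows "SP_forces q (starts_with t x_gen)"
  unfolding starts_with_def forces_All_in
proof
  fix i
  assume "i \<in> {..<length t}"
  then have "x i = t ! i" if "x \<in> branches q" for x
    using assms[OF that] nth_initial[of i "length t" x] by simp
  then have "((i, t ! i), r) \<in> x_gen" if "r \<in> SP" "r \<subseteq> q" for r
    using that branches_mono[of r q] by (auto simp: x_gen_def)
  then have "\<exists>r\<in>SP. r \<subseteq> p \<and> (\<exists>s. ((i, t ! i), s) \<in> x_gen \<and> r \<subseteq> s)"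
    if "p \<in> SP" "p \<subseteq> q" for p
    using that by blast
  then show "SP_forces q (Mem (i, t ! i) x_gen)"
    unfolding forces.simps(1) by blast
qed

text \<open>This transfers a bound on ground-model branches to the generic real by density: below
  any \<open>q\<close>, take a branch \<open>x\<close> and an initial segment \<open>t\<close> of it
  that decides \<open>f\<close> at \<open>n\<close>. Restricting \<open>q\<close> to
  \<open>t\<close> forces the value \<open>f x n\<close>, which lies in \<open>K\<close>.\<close>

lemma SP_forces_value_in:
  assumes S: "S \<subseteq> T"
    and cont: "continuous_on (branches T) (\<lambda>x. f x n)"
    and K: "\<And>x. x \<in> branches S \<Longrightarrow> f x n \<in> K"
  shows "SP_forces S (value_in T f x_gen n K)"
  unfolding value_in_def forces_Ex_in
proof (intro ballI impI)
  fix q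
  assume "q \<in> SP" "q \<subseteq> S"
  then have q: "splitting_tree q"
    by (simp add: SP_def)
  then obtain x where x: "x \<in> branches q"
    using splitting_tree_has_branch by blast
  then have xT: "x \<in> branches T" and xS: "x \<in> branches S"
    using S \<open>q \<subseteq> S\<close> by (auto simp: branches_def)
  obtain m where m: "\<And>y. y \<in> branches T \<Longrightarrow> initial y m = initial x m \<Longrightarrow> f y n = f x n"
    using continuous_on_initial_nbhd[OF cont xT] by blast
  define t where "t = initial x m"
  define r where "r = restrict_tree q t"
  have "t \<in> q"
    using x by (simp add: branches_def t_def)
  then have "r \<in> SP"
    unfolding r_def SP_def using splitting_tree_restrict_tree[OF q] by simp
  have "r \<subseteq> q"
    unfolding r_def restrict_tree_def by blast
  have t: "t \<in> decides_value T f n (f x n)"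
  proof -
    have "t \<in> T"
      using xT by (simp add: branches_def t_def)
    moreover have "f y n = f x n" if "y \<in> branches T" "initial y (length t) = t" for y
      using m[OF that(1)] that(2) by (simp add: t_def)
    ultimately show ?thesis
      unfolding decides_value_def by blast
  qed
  have "SP_forces r (value_eq T f x_gen n (f x n))"
    unfolding value_eq_def forces_Ex_in
  proof (intro ballI impI)
    fix q'
    assume "q' \<in> SP" "q' \<subseteq> r"
    then have "SP_forces q' (starts_with t x_gen)"
      using branch_restrict_tree branches_mono unfolding r_def by (intro SP_forces_starts_with) blast
    then show "\<exists>p\<in>SP. p \<subseteq> q' \<and> (\<exists>s\<in>decides_value T f n (f x n). SP_forces p (starts_with s x_gen))"
      using t \<open>q' \<in> SP\<close> by blast
  qed
  then show "\<exists>r\<in>SP. r \<subseteq> q \<and> (\<exists>k\<in>K. SP_forces r (value_eq T f x_gen n k))"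
    using \<open>r \<in> SP\<close> \<open>r \<subseteq> q\<close> K[OF xS] by blast
qed

section \<open>The parity coloring\<close>

text \<open>For \<open>A = {x, y}\<close> with \<open>x \<noteq> y\<close> this is \<Delta>(x, y).
  It takes a set because colorings are functions of unordered pairs.\<close>

definition diff_level :: "(nat \<Rightarrow> bool) set \<Rightarrow> nat" where
  "diff_level A = (LEAST n. \<exists>x\<in>A. \<exists>y\<in>A. x n \<noteq> y n)"

lemma diff_level_eqI:
  assumes "x d \<noteq> y d" "initial x d = initial y d"
  shows "diff_level {x, y} = d"
  unfolding diff_level_def using assms
  by (intro Least_equality) (auto simp: initial_eq_iff not_less[symmetric])

lemma diff_level_exists:
  assumes "x \<noteq> y"
  obtains d where "x d \<noteq> y d" "initial x d = initial y d"
proof -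
  have "\<exists>n. x n \<noteq> y n"
    using assms by auto
  then have "x (LEAST n. x n \<noteq> y n) \<noteq> y (LEAST n. x n \<noteq> y n)"
    by (rule LeastI_ex)
  moreover have "initial x (LEAST n. x n \<noteq> y n) = initial y (LEAST n. x n \<noteq> y n)"
    using not_less_Least by (auto simp: initial_eq_iff)
  ultimately show ?thesis
    using that by blast
qed

text \<open>Off the diagonal, \<Delta> is locally constant.\<close>

lemma continuous_coloring_diff_level: "continuous_coloring X (\<lambda>A. P (diff_level A))"
  unfolding continuous_coloring_def continuous_on_topological
proof (intro ballI allI impI)
  fix z and B :: "bool set"
  assume "z \<in> {(x, y). x \<in> X \<and> y \<in> X \<and> x \<noteq> y}"
    and B: "(case z of (x, y) \<Rightarrow> P (diff_level {x, y})) \<in> B"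
  then obtain x y where z: "z = (x, y)" and "x \<noteq> y"
    by auto
  from \<open>x \<noteq> y\<close> obtain d where d: "x d \<noteq> y d" "initial x d = initial y d"
    by (rule diff_level_exists)
  \<comment> \<open>Length \<open>Suc d\<close> fixes the coordinate \<open>d\<close> where
    \<open>x\<close> and \<open>y\<close> differ, as well as the common part before it.\<close>
  define A where "A = {u. initial u (Suc d) = initial x (Suc d)} \<times> {v. initial v (Suc d) = initial y (Suc d)}"
  have "open A"
    unfolding A_def
    by (intro open_Times open_initial_vimage[of "\<lambda>s. s = initial x (Suc d)"]
        open_initial_vimage[of "\<lambda>s. s = initial y (Suc d)"])
  moreover have "z \<in> A"
    by (simp add: A_def z)
  moreover have "P (diff_level {u, v}) \<in> B" if "(u, v) \<in> A" for u v
  proof -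
    have "u d \<noteq> v d" "initial u d = initial v d"
      using that d by (auto simp: A_def initial_eq_iff)
    then have "diff_level {u, v} = d"
      by (rule diff_level_eqI)
    then show ?thesis
      using diff_level_eqI[of x d y, OF d] B z by simp
  qed
  ultimately show "\<exists>A. open A \<and> z \<in> A \<and> (\<forall>w\<in>{(x, y). x \<in> X \<and> y \<in> X \<and> x \<noteq> y}.
      w \<in> A \<longrightarrow> (case w of (x, y) \<Rightarrow> P (diff_level {x, y})) \<in> B)"
    by (intro exI[of _ A]) auto
qed

text \<open>A pair that agrees up to \<open>m k\<close> but not up to \<open>m (Suc k)\<close> has
  its difference level in that interval. Its color is then the parity of \<open>k\<close>, which is
  opposite to the homogeneous color \<open>b\<close>.\<close>

lemma no_split_if_homogeneous:
  fixes m :: "nat \<Rightarrow> nat"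
  assumes m: "strict_mono m"
    and hom: "\<And>x y. x \<in> X \<Longrightarrow> y \<in> X \<Longrightarrow> x \<noteq> y \<Longrightarrow> even (LEAST k. diff_level {x, y} < m (Suc k)) = b"
    and k: "even k \<noteq> b"
    and xy: "x \<in> X" "y \<in> X" "initial x (m k) = initial y (m k)"
  shows "initial x (m (Suc k)) = initial y (m (Suc k))"
proof (rule ccontr)
  assume neq: "initial x (m (Suc k)) \<noteq> initial y (m (Suc k))"
  then have "x \<noteq> y"
    by auto
  then obtain d where d: "x d \<noteq> y d" "initial x d = initial y d"
    by (rule diff_level_exists)
  have "\<not> d < m k"
    using xy(3) d(1) unfolding initial_eq_iff by blast
  then have "m k \<le> d"
    by simp
  obtain i where "i < m (Suc k)" "x i \<noteq> y i"
    using neq unfolding initial_eq_iff by blast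
  then have "d < m (Suc k)"
    using d(2) unfolding initial_eq_iff by (metis not_less order_le_less_trans)
  have "k \<le> j" if "d < m (Suc j)" for j
  proof -
    have "m k < m (Suc j)"
      using \<open>m k \<le> d\<close> that by linarith
    then show ?thesis
      using strict_mono_less[OF m, of k "Suc j"] by linarith
  qed
  with \<open>d < m (Suc k)\<close> have "(LEAST k. d < m (Suc k)) = k"
    by (rule Least_equality)
  then show False
    using hom[OF xy(1,2) \<open>x \<noteq> y\<close>] k diff_level_eqI[OF d] by simp
qed

section \<open>Counting values and choosing levels\<close>

lemma card_image_le_if_initial:
  assumes "\<And>x y. x \<in> X \<Longrightarrow> y \<in> X \<Longrightarrow> initial x m = initial y m \<Longrightarrow> h x = h y"
  shows "finite (h ` X)" "card (h ` X) \<le> 2 ^ m"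
proof -
  define L where "L = {s :: bool list. set s \<subseteq> UNIV \<and> length s = m}"
  \<comment> \<open>\<open>h\<close> factors through strings of length \<open>m\<close>. On a string
    that no element of \<open>X\<close> extends, \<open>r\<close> is arbitrary, which is harmless
    for the inclusion below.\<close>
  define r where "r = (\<lambda>s. h (SOME x. x \<in> X \<and> initial x m = s))"
  have sub: "h ` X \<subseteq> r ` L"
  proof
    fix v
    assume "v \<in> h ` X"
    then obtain x where x: "x \<in> X" "v = h x"
      by blast
    define y where "y = (SOME y. y \<in> X \<and> initial y m = initial x m)"
    have "y \<in> X \<and> initial y m = initial x m"
      unfolding y_def by (rule someI[of _ x]) (simp add: x(1))
    then have "h y = h x"
      using assms x(1) by blast
    then have "r (initial x m) = v"
      by (simp add: r_def y_def x(2))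
    moreover have "initial x m \<in> L"
      by (simp add: L_def)
    ultimately show "v \<in> r ` L"
      by blast
  qed
  have L: "finite L" "card L = 2 ^ m"
    using finite_lists_length_eq[of "UNIV :: bool set" m] card_lists_length_eq[of "UNIV :: bool set" m]
    by (simp_all add: L_def)
  show "finite (h ` X)"
    using sub L(1) by (meson finite_imageI finite_subset)
  show "card (h ` X) \<le> 2 ^ m"
    using surj_card_le[OF L(1) sub] L(2) by simp
qed

text \<open>The sets \<open>H n\<close> must have exactly \<open>g n\<close> elements, so a smaller
  set of values is padded from its infinite complement.\<close>

lemma nsets_superset:
  fixes A :: "nat set"
  assumes "finite A" "card A \<le> k"
  shows "\<exists>B\<in>nsets UNIV k. A \<subseteq> B"
proof -
  have "infinite (- A)"
    using assms(1) by (simp add: Compl_eq_Diff_UNIV)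
  then obtain C where C: "finite C" "card C = k - card A" "C \<subseteq> - A"
    by (metis infinite_arbitrarily_large)
  then have "A \<inter> C = {}"
    by blast
  then have "card (A \<union> C) = k"
    using C assms by (simp add: card_Un_disjoint)
  then show ?thesis
    using C(1) assms(1) by (intro bexI[of _ "A \<union> C"]) (auto simp: nsets_def)
qed

text \<open>The choices alternate: once \<open>m k\<close> is known, \<open>N k\<close> is taken so
  far out that \<open>g (N k)\<close> reaches \<open>2 ^ m k\<close>; then \<open>m (Suc k)\<close>
  is taken large enough to determine \<open>f\<close> at \<open>N k\<close>.\<close>

lemma fast_sequence:
  fixes g :: "nat \<Rightarrow> nat" and f :: "(nat \<Rightarrow> bool) \<Rightarrow> nat \<Rightarrow> nat"
  assumes g: "filterlim g at_top sequentially"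
    and cont: "\<And>n. continuous_on (branches T) (\<lambda>x. f x n)"
  obtains m N :: "nat \<Rightarrow> nat" where "strict_mono m"
    and "\<And>k. k \<le> N k" and "\<And>k. 2 ^ m k \<le> g (N k)"
    and "\<And>k x y. x \<in> branches T \<Longrightarrow> y \<in> branches T \<Longrightarrow>
           initial x (m (Suc k)) = initial y (m (Suc k)) \<Longrightarrow> f x (N k) = f y (N k)"
proof -
  have "\<forall>n. \<exists>l. \<forall>x\<in>branches T. \<forall>y\<in>branches T. initial x l = initial y l \<longrightarrow> f x n = f y n"
    using continuous_on_branches_uniform[OF cont] by blast
  then obtain l where
    l: "\<And>n x y. x \<in> branches T \<Longrightarrow> y \<in> branches T \<Longrightarrow> initial x (l n) = initial y (l n) \<Longrightarrow> f x n = f y n"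
    by metis
  have "\<forall>j k. \<exists>n. k \<le> n \<and> 2 ^ j \<le> g n"
  proof (intro allI)
    fix j k
    have "eventually (\<lambda>n. 2 ^ j \<le> g n) sequentially"
      using g by (simp add: filterlim_at_top)
    then obtain n0 where "\<forall>n\<ge>n0. 2 ^ j \<le> g n"
      unfolding eventually_sequentially by blast
    then show "\<exists>n. k \<le> n \<and> 2 ^ j \<le> g n"
      by (intro exI[of _ "max k n0"]) simp
  qed
  then obtain M where M: "\<And>j k. k \<le> M j k" "\<And>j k. 2 ^ j \<le> g (M j k)"
    by metis
  \<comment> \<open>In the maximum, \<open>Suc j\<close> makes \<open>m\<close> strictly increasing
    and \<open>l (M j k)\<close> is the length that determines the value at
    \<open>N k\<close>.\<close>
  define m where "m = rec_nat 0 (\<lambda>k j. max (Suc j) (l (M j k)))"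
  define N where "N = (\<lambda>k. M (m k) k)"
  have m_Suc: "m (Suc k) = max (Suc (m k)) (l (N k))" for k
    by (simp add: m_def N_def)
  have "strict_mono m"
    unfolding strict_mono_Suc_iff using m_Suc by (simp add: less_max_iff_disj)
  moreover have "k \<le> N k" "2 ^ m k \<le> g (N k)" for k
    using M by (simp_all add: N_def)
  moreover have "f x (N k) = f y (N k)"
    if "x \<in> branches T" "y \<in> branches T" "initial x (m (Suc k)) = initial y (m (Suc k))" for k x y
    using that m_Suc[of k] by (intro l) (auto simp: initial_eq_iff)
  ultimately show ?thesis
    by (rule that[of m N])
qed

text \<open>Different \<open>k\<close> may share a value \<open>N k\<close>, but
  \<open>k \<le> N k\<close> still makes the image of an infinite set unbounded.\<close>

lemma infinite_image_ge_self:
  fixes N :: "nat \<Rightarrow> nat"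
  assumes "infinite I" "\<And>k. k \<le> N k"
  shows "infinite (N ` I)"
  unfolding infinite_nat_iff_unbounded_le
proof
  fix n
  obtain k where "n \<le> k" "k \<in> I"
    using assms(1) unfolding infinite_nat_iff_unbounded_le by blast
  then show "\<exists>l\<ge>n. l \<in> N ` I"
    using assms(2)[of k] by (intro exI[of _ "N k"]) auto
qed

lemma infinite_parity_neq: "infinite {k::nat. even k \<noteq> b}"
  unfolding infinite_nat_iff_unbounded_le
proof
  fix n :: nat
  show "\<exists>k\<ge>n. k \<in> {k. even k \<noteq> b}"
    by (cases "even n \<noteq> b") (auto intro: exI[of _ "Suc n"] exI[of _ n])
qed

theorem theorem3p1:
  fixes T :: tree
  assumes "splitting_tree T"
    and "SP_arrow_cont T"
  shows "wsacks_cont T"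
  unfolding wsacks_cont_def
proof (intro allI impI, elim conjE)
  fix g :: "nat \<Rightarrow> nat" and f :: "(nat \<Rightarrow> bool) \<Rightarrow> nat \<Rightarrow> nat"
  assume g: "filterlim g at_top sequentially" and f: "continuous_on (branches T) f"
  have cont: "continuous_on (branches T) (\<lambda>x. f x n)" for n
    using f by (rule continuous_on_product_then_coordinatewise)
  obtain m N :: "nat \<Rightarrow> nat" where m: "strict_mono m"
    and N: "\<And>k. k \<le> N k" "\<And>k. 2 ^ m k \<le> g (N k)"
    and fN: "\<And>k x y. x \<in> branches T \<Longrightarrow> y \<in> branches T \<Longrightarrow>
           initial x (m (Suc k)) = initial y (m (Suc k)) \<Longrightarrow> f x (N k) = f y (N k)"
    by (rule fast_sequence[of g T f, OF g cont]) (rule that)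
  \<comment> \<open>The \<open>LEAST\<close> is the index of the interval from \<open>m k\<close> to
    \<open>m (Suc k)\<close> containing the difference level; levels below \<open>m 0\<close>, if
    any, get index 0.\<close>
  define c where "c = (\<lambda>A. even (LEAST k. diff_level A < m (Suc k)))"
  have "continuous_coloring (branches T) c"
    unfolding c_def by (rule continuous_coloring_diff_level)
  then obtain S where S: "splitting_tree S" "S \<subseteq> T" and "c constant_on nsets (branches S) 2"
    using assms(2) unfolding SP_arrow_cont_def by blast
  then obtain b where b: "\<And>A. A \<in> nsets (branches S) 2 \<Longrightarrow> c A = b"
    unfolding constant_on_def by blast
  \<comment> \<open>Two branches of \<open>S\<close> can first differ only in intervals whose index
    has parity \<open>b\<close>; \<open>I\<close> collects the other indices.\<close>
  define I where "I = {k::nat. even k \<noteq> b}"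
  have "\<exists>B\<in>nsets UNIV (g (N k)). (\<lambda>x. f x (N k)) ` branches S \<subseteq> B" if "k \<in> I" for k
  proof -
    have "f x (N k) = f y (N k)"
      if xy: "x \<in> branches S" "y \<in> branches S" "initial x (m k) = initial y (m k)" for x y
    proof -
      have "initial x (m (Suc k)) = initial y (m (Suc k))"
        using \<open>k \<in> I\<close> b xy unfolding c_def I_def
        by (intro no_split_if_homogeneous[OF m, where X = "branches S" and b = b]) auto
      then show ?thesis
        using fN xy branches_mono[OF S(2)] by blast
    qed
    note few = card_image_le_if_initial[of "branches S" "m k" "\<lambda>x. f x (N k)", OF this]
    show ?thesis
      by (rule nsets_superset[OF few(1) order_trans[OF few(2) N(2)]])
  qed
  \<comment> \<open>The claim for \<open>k\<close> depends on \<open>k\<close> only through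
    \<open>N k\<close>, so \<open>H\<close> can be chosen as a function of
    \<open>n = N k\<close>.\<close>
  then have "\<forall>n\<in>N ` I. \<exists>B. B \<in> nsets UNIV (g n) \<and> (\<lambda>x. f x n) ` branches S \<subseteq> B"
    by blast
  then obtain H where H: "\<forall>n\<in>N ` I. H n \<in> nsets UNIV (g n) \<and> (\<lambda>x. f x n) ` branches S \<subseteq> H n"
    by (rule bchoice[THEN exE])
  have "SP_forces S (All_in (N ` I) (\<lambda>n. value_in T f x_gen n (restrict H (N ` I) n)))"
    unfolding forces_All_in
  proof
    fix n
    assume "n \<in> N ` I"
    then show "SP_forces S (value_in T f x_gen n (restrict H (N ` I) n))"
      using H by (intro SP_forces_value_in S cont) auto
  qed
  moreover have "infinite (N ` I)"
    unfolding I_def by (intro infinite_image_ge_self infinite_parity_neq N)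
  moreover have "restrict H (N ` I) \<in> (\<Pi>\<^sub>E n\<in>N ` I. nsets UNIV (g n))"
    using H by auto
  ultimately show "\<exists>S a H. splitting_tree S \<and> S \<subseteq> T \<and> infinite a \<and>
      H \<in> (\<Pi>\<^sub>E n\<in>a. nsets UNIV (g n)) \<and> SP_forces S (All_in a (\<lambda>n. value_in T f x_gen n (H n)))"
    using S by blast
qed

end
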